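(* For a graph $G$ with chromatic number $\chi(G)$, let $G^{1/2}$ denote the graph obtained from $G$ by subdividing every edge exactly once. Then $$\pi(G^{1/2}) \leq \log\log(\chi(G)-1) + \left(\frac{1}{2}+o(1)\right)\log\log\log(\chi(G)-1) + 2,$$ where $o(1)$ denotes a quantity tending to $0$ as $\chi(G) \to \infty$.
   Context: All graphs are finite, simple and undirected; $\log$ denotes the logarithm to base $2$. Subdividing an edge $\{x,y\}$ once means replacing it by a path $x, w, y$ through a new vertex $w$ of degree $2$. A permutation of a finite set $U$ is a bijection $\sigma: U \to [|U|]$. For disjoint $A,B \subseteq U$, write $A \prec_\sigma B$ if $\sigma(a)<\sigma(b)$ for all $a \in A$, $b \in B$; $\sigma$ separates $A$ and $B$ if $A \prec_\sigma B$ or $B \prec_\sigma A$. A family $\mathcal{F}$ of permutations of $V(H)$ is pairwise suitable for a graph $H$ if for every two disjoint edges $e,f$ of $H$ (viewed as 2-element vertex sets) some $\sigma \in \mathcal{F}$ separates $e$ and $f$. The separation dimension $\pi(H)$ is the minimum cardinality of a family of permutations of $V(H)$ that is pairwise suitable for $H$. *)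

theory Defs
  imports Complex_Main "HOL-Library.FuncSet"
begin

record 'a graph =
  verts :: "'a set"
  edges :: "'a set set"

definition simple_graph :: "'a graph \<Rightarrow> bool" where
  "simple_graph G \<longleftrightarrow>
     finite (verts G) \<and> (\<forall>e\<in>edges G. e \<subseteq> verts G \<and> card e = 2)"

definition proper_coloring :: "'a graph \<Rightarrow> nat \<Rightarrow> ('a \<Rightarrow> nat) \<Rightarrow> bool" where
  "proper_coloring G k c \<longleftrightarrow>
     c \<in> verts G \<rightarrow> {..<k} \<and> (\<forall>x y. {x, y} \<in> edges G \<longrightarrow> c x \<noteq> c y)"

definition chromatic_number :: "'a graph \<Rightarrow> nat" where
  "chromatic_number G = (LEAST k. \<exists>c. proper_coloring G k c)"

(* The original vertices are tagged Inl; the new vertex of degree 2 placed on the edge e is Inr e. *)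
definition subdivision :: "'a graph \<Rightarrow> ('a + 'a set) graph" where
  "subdivision G =
     \<lparr> verts = verts G <+> edges G,
       edges = {{Inl x, Inr e} | x e. e \<in> edges G \<and> x \<in> e} \<rparr>"

(* Extensionality gives every permutation of U exactly one representing function, so that
   families of permutations can be counted as sets of functions. *)
definition permutations_on :: "'a set \<Rightarrow> ('a \<Rightarrow> nat) set" where
  "permutations_on U = {\<sigma> \<in> extensional U. bij_betw \<sigma> U {1..card U}}"

definition precedes :: "('a \<Rightarrow> nat) \<Rightarrow> 'a set \<Rightarrow> 'a set \<Rightarrow> bool" where
  "precedes \<sigma> A B \<longleftrightarrow> (\<forall>a\<in>A. \<forall>b\<in>B. \<sigma> a < \<sigma> b)"

definition separates :: "('a \<Rightarrow> nat) \<Rightarrow> 'a set \<Rightarrow> 'a set \<Rightarrow> bool" where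
  "separates \<sigma> A B \<longleftrightarrow> precedes \<sigma> A B \<or> precedes \<sigma> B A"

definition pairwise_suitable :: "'a graph \<Rightarrow> ('a \<Rightarrow> nat) set \<Rightarrow> bool" where
  "pairwise_suitable H F \<longleftrightarrow>
     F \<subseteq> permutations_on (verts H) \<and>
     (\<forall>e\<in>edges H. \<forall>f\<in>edges H. e \<inter> f = {} \<longrightarrow> (\<exists>\<sigma>\<in>F. separates \<sigma> e f))"

definition separation_dimension :: "'a graph \<Rightarrow> nat" where
  "separation_dimension H =
     (LEAST k. \<exists>F. finite F \<and> card F = k \<and> pairwise_suitable H F)"

end

theory Submission
  imports Defs "HOL-Library.Product_Lexorder" "HOL-Real_Asymp.Real_Asymp"
begin

text \<open>Colour \<open>G\<close> with \<open>n = \<chi>(G)\<close> colours and order the vertices of \<open>G\<close> by colour, placing each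
  subdivision vertex directly after the lower endpoint of its edge. Two disjoint edges \<open>{x, e}\<close>,
  \<open>{y, f}\<close> of the subdivision, with \<open>e = {x, x'}\<close> and \<open>f = {y, y'}\<close>, are then separated as soon as one
  colour lies below two others in a suitable colour order, unless \<open>x, y'\<close> share one colour and
  \<open>x', y\<close> another; two extra orders, opposite within the colour classes, cover this case.

  Orders of the colours in which each colour lies below any two others at least once come from
  Spencer's construction. The \<open>s\<close>-subsets of a \<open>2s\<close>-set through a fixed point are qualitatively
  independent, and there are \<open>m = C(2s-1, s-1) \<ge> 4^s / (4 sqrt s)\<close> of them. Encode colours as
  subsets of \<open>{0..<m}\<close>; the \<open>i\<close>-th order is the lexicographic one, reversed at those coordinates
  \<open>j\<close> for which the \<open>j\<close>-th set contains \<open>i\<close>. Hence \<open>2s + 2\<close> permutations suffice once \<open>n \<le> 2^m\<close>,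
  and solving for \<open>s\<close> gives the bound.\<close>

section \<open>Permutations from sort keys\<close>

text \<open>Sort by \<open>key\<close>, break ties by an injective index, and take ranks. Later
  orders can thus be given as keys in any linear order, with ties allowed.\<close>

lemma permutation_from_key:
  fixes key :: "'a \<Rightarrow> 'b::linorder"
  assumes fin: "finite U"
  obtains \<sigma> where "\<sigma> \<in> permutations_on U"
    "\<And>u v. u \<in> U \<Longrightarrow> v \<in> U \<Longrightarrow> key u < key v \<Longrightarrow> \<sigma> u < \<sigma> v"
proof -
  obtain idx :: "'a \<Rightarrow> nat" where idx: "inj_on idx U"
    using finite_imp_inj_to_nat_seg[OF fin] by blast
  define k where "k u = (key u, idx u)" for u
  have k_inj: "u = v" if "u \<in> U" "v \<in> U" "k u = k v" for u v
    using that idx by (auto simp: k_def inj_on_def)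
  \<comment> \<open>With \<open>\<le>\<close> the rank counts \<open>u\<close> itself, so ranks
    start at 1.\<close>
  define \<sigma> where "\<sigma> = restrict (\<lambda>u. card {w\<in>U. k w \<le> k u}) U"
  have mono: "\<sigma> u < \<sigma> v" if "u \<in> U" "v \<in> U" "k u < k v" for u v
  proof -
    have "{w\<in>U. k w \<le> k u} \<subset> {w\<in>U. k w \<le> k v}"
      using that by force
    then show ?thesis
      using that fin by (simp add: \<sigma>_def psubset_card_mono)
  qed
  have inj: "inj_on \<sigma> U"
  proof (rule inj_onI)
    fix u v assume uv: "u \<in> U" "v \<in> U" "\<sigma> u = \<sigma> v"
    then have "k u = k v"
      using mono[of u v] mono[of v u] by (cases "k u" "k v" rule: linorder_cases) auto
    with uv show "u = v" using k_inj by blast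
  qed
  have "\<sigma> u \<in> {1..card U}" if u: "u \<in> U" for u
  proof -
    have "card {w\<in>U. k w \<le> k u} > 0"
      using u fin by (auto simp: card_gt_0_iff)
    moreover have "card {w\<in>U. k w \<le> k u} \<le> card U"
      using fin by (intro card_mono) auto
    ultimately show ?thesis using u by (simp add: \<sigma>_def)
  qed
  then have "\<sigma> ` U \<subseteq> {1..card U}" by blast
  then have "\<sigma> ` U = {1..card U}"
    by (intro card_subset_eq) (simp_all add: card_image[OF inj])
  then have "\<sigma> \<in> permutations_on U"
    using inj by (simp add: permutations_on_def bij_betw_def \<sigma>_def)
  moreover have "\<sigma> u < \<sigma> v" if "u \<in> U" "v \<in> U" "key u < key v" for u v
    using that by (intro mono) (simp_all add: k_def)
  ultimately show thesis using that by blast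
qed

section \<open>Scrambling orders of the colours\<close>

text \<open>Binary comparison is decided at the top differing bit \<open>d\<close>, because all bits
  below it add up to less than \<open>2 ^ d\<close>. This realises the lexicographic order on
  subsets by numbers.\<close>

lemma sum_power2_less_iff_Max_sym_diff:
  fixes X Y :: "nat set"
  assumes fin: "finite X" "finite Y" and ne: "X \<noteq> Y"
  shows "(\<Sum>j\<in>X. 2 ^ j :: nat) < (\<Sum>j\<in>Y. 2 ^ j) \<longleftrightarrow> Max (sym_diff X Y) \<in> Y"
proof -
  have less: "(\<Sum>j\<in>X. 2 ^ j :: nat) < (\<Sum>j\<in>Y. 2 ^ j)"
    if fin: "finite X" "finite Y" and d: "d \<in> Y - X" and top: "\<And>j. j \<in> X - Y \<Longrightarrow> j < d"
    for X Y :: "nat set" and d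
  proof -
    have "(\<Sum>j\<in>X - Y. 2 ^ j :: nat) \<le> (\<Sum>j<d. 2 ^ j)"
      using top by (intro sum_mono2) auto
    also have "\<dots> < 2 ^ d"
      by (induction d) auto
    also have "\<dots> \<le> (\<Sum>j\<in>Y - X. 2 ^ j)"
      using fin d by (intro member_le_sum) auto
    finally have "(\<Sum>j\<in>X - Y. 2 ^ j :: nat) < (\<Sum>j\<in>Y - X. 2 ^ j)" .
    moreover have "(\<Sum>j\<in>X. 2 ^ j :: nat) = (\<Sum>j\<in>X \<inter> Y. 2 ^ j) + (\<Sum>j\<in>X - Y. 2 ^ j)"
      using fin(1) by (metis sum.Int_Diff)
    moreover have "(\<Sum>j\<in>Y. 2 ^ j :: nat) = (\<Sum>j\<in>X \<inter> Y. 2 ^ j) + (\<Sum>j\<in>Y - X. 2 ^ j)"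
      using fin(2) by (metis sum.Int_Diff Int_commute)
    ultimately show ?thesis by linarith
  qed
  define d where "d = Max (sym_diff X Y)"
  have d: "d \<in> sym_diff X Y"
    unfolding d_def using fin ne by (intro Max_in) auto
  have top: "j < d" if "j \<in> sym_diff X Y" "j \<noteq> d" for j
  proof -
    have "j \<le> d" unfolding d_def using that fin by (intro Max_ge) auto
    then show ?thesis using that by simp
  qed
  show ?thesis
  proof (cases "d \<in> Y")
    case True
    then have "(\<Sum>j\<in>X. 2 ^ j :: nat) < (\<Sum>j\<in>Y. 2 ^ j)"
      using d top by (intro less[of X Y d] fin) auto
    with True show ?thesis by (simp add: d_def)
  next
    case False
    then have "(\<Sum>j\<in>Y. 2 ^ j :: nat) < (\<Sum>j\<in>X. 2 ^ j)"
      using d top by (intro less[of Y X d] fin) auto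
    with False show ?thesis by (simp add: d_def)
  qed
qed

text \<open>All sets have size \<open>s\<close> and contain 0. Equal sizes make distinct sets
  incomparable, which gives the two mixed patterns; 0 gives the pattern inside both; and two meeting
  \<open>s\<close>-sets cannot cover \<open>2 * s\<close> points, which gives the pattern outside
  both.\<close>

lemma qualitatively_independent_family:
  assumes s: "s \<ge> 1"
  obtains A :: "nat \<Rightarrow> nat set" where
    "\<And>j l P Q. j < (2 * s - 1) choose (s - 1) \<Longrightarrow> l < (2 * s - 1) choose (s - 1) \<Longrightarrow>
       (j = l \<Longrightarrow> P = Q) \<Longrightarrow> \<exists>i<2 * s. (i \<in> A j \<longleftrightarrow> P) \<and> (i \<in> A l \<longleftrightarrow> Q)"
proof -
  define m where "m = (2 * s - 1) choose (s - 1)"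
  define \<B> where "\<B> = {B. B \<subseteq> {1..<2 * s} \<and> card B = s - 1}"
  have "finite \<B>" "card \<B> = m"
    using n_subsets[of "{1..<2 * s}" "s - 1"] by (auto simp: \<B>_def m_def)
  then obtain h where h: "bij_betw h {..<m} \<B>"
    using ex_bij_betw_nat_finite[of \<B>] by (auto simp: atLeast0LessThan)
  define A where "A j = insert 0 (h j)" for j
  have hB: "h j \<subseteq> {1..<2 * s}" "card (h j) = s - 1" "finite (h j)" if "j < m" for j
    using h that by (auto simp: bij_betw_def \<B>_def intro: finite_subset)
  have cardA: "card (A j) = s" and Asub: "A j \<subseteq> {..<2 * s}" and finA: "finite (A j)"
    and zero: "0 \<in> A j" if "j < m" for j
  proof -
    have "0 \<notin> h j" using hB(1)[OF that] by auto
    then show "card (A j) = s" using hB[OF that] s by (simp add: A_def)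
    show "A j \<subseteq> {..<2 * s}" "finite (A j)" "0 \<in> A j"
      using hB[OF that] s by (auto simp: A_def)
  qed
  have diff: "\<exists>i<2 * s. i \<in> A j \<and> i \<notin> A l" if "j < m" "l < m" "j \<noteq> l" for j l
  proof -
    have "h j \<noteq> h l" using h that by (auto simp: bij_betw_def inj_on_def)
    moreover have "0 \<notin> h j" "0 \<notin> h l" using hB(1)[of j] hB(1)[of l] that by auto
    ultimately have "A j \<noteq> A l" by (simp add: A_def insert_ident)
    then have "\<not> A j \<subseteq> A l"
      using card_subset_eq[OF finA[OF that(2)]] cardA[OF that(1)] cardA[OF that(2)] by auto
    then show ?thesis using Asub[of j] that by blast
  qed
  have outside: "\<exists>i<2 * s. i \<notin> A j \<and> i \<notin> A l" if "j < m" "l < m" for j l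
  proof -
    have "card (A j \<union> A l) + card (A j \<inter> A l) = 2 * s"
      using card_Un_Int[OF finA[OF that(1)] finA[OF that(2)]] cardA[OF that(1)] cardA[OF that(2)]
      by linarith
    moreover have "card (A j \<inter> A l) > 0"
      using zero[OF that(1)] zero[OF that(2)] finA[OF that(1)] by (auto simp: card_gt_0_iff)
    ultimately have "card (A j \<union> A l) < card {..<2 * s}" by simp
    then have "A j \<union> A l \<noteq> {..<2 * s}" by (metis less_irrefl)
    then show ?thesis using Asub[OF that(1)] Asub[OF that(2)] by blast
  qed
  have quadrants: "\<exists>i<2 * s. (i \<in> A j \<longleftrightarrow> P) \<and> (i \<in> A l \<longleftrightarrow> Q)"
    if "j < m" "l < m" "j = l \<Longrightarrow> P = Q" for j l P Q
  proof (cases P; cases Q)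
    assume "P" "Q" then show ?thesis using zero that s by (intro exI[of _ 0]) auto
  next
    assume "P" "\<not> Q" then show ?thesis using diff[of j l] that by auto
  next
    assume "\<not> P" "Q" then show ?thesis using diff[of l j] that by auto
  next
    assume "\<not> P" "\<not> Q" then show ?thesis using outside[of j l] that by auto
  qed
  show thesis by (rule that) (fact quadrants[unfolded m_def])
qed

lemma scrambling_orders:
  assumes s: "s \<ge> 1" and n: "n \<le> 2 ^ ((2 * s - 1) choose (s - 1))"
  obtains p :: "nat \<Rightarrow> nat \<Rightarrow> nat" where
    "\<And>a b c. a < n \<Longrightarrow> b < n \<Longrightarrow> c < n \<Longrightarrow> a \<noteq> b \<Longrightarrow> a \<noteq> c \<Longrightarrow>
       \<exists>i<2 * s. p i a < p i b \<and> p i a < p i c"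
proof -
  define m where "m = (2 * s - 1) choose (s - 1)"
  obtain A :: "nat \<Rightarrow> nat set" where A: "\<And>j l P Q. j < m \<Longrightarrow> l < m \<Longrightarrow>
       (j = l \<Longrightarrow> P = Q) \<Longrightarrow> \<exists>i<2 * s. (i \<in> A j \<longleftrightarrow> P) \<and> (i \<in> A l \<longleftrightarrow> Q)"
    using qualitatively_independent_family[OF s] unfolding m_def by metis
  have "card {..<n} \<le> card (Pow {..<m})"
    using n by (simp add: card_Pow m_def)
  then obtain \<beta> where \<beta>: "\<beta> ` {..<n} \<subseteq> Pow {..<m}" "inj_on \<beta> {..<n}"
    using card_le_inj[of "{..<n}" "Pow {..<m}"] by auto
  define M where "M i = {j. j < m \<and> i \<in> A j}" for i
  \<comment> \<open>Symmetric difference with \<open>M i\<close> is bitwise xor: it reverses the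
    comparison exactly at the coordinates in \<open>M i\<close>.\<close>
  define p where "p i a = (\<Sum>j\<in>sym_diff (\<beta> a) (M i). 2 ^ j :: nat)" for i a
  define D where "D a b = Max (sym_diff (\<beta> a) (\<beta> b))" for a b
  have fin: "finite (\<beta> a)" if "a < n" for a
    using \<beta>(1) that by (auto intro: finite_subset[of _ "{..<m}"])
  have D: "D a b \<in> sym_diff (\<beta> a) (\<beta> b)" "D a b < m" if "a < n" "b < n" "a \<noteq> b" for a b
  proof -
    have "\<beta> a \<noteq> \<beta> b" using \<beta>(2) that by (auto simp: inj_on_def)
    then show "D a b \<in> sym_diff (\<beta> a) (\<beta> b)"
      unfolding D_def using fin that by (intro Max_in) auto
    then show "D a b < m" using \<beta>(1) that by auto
  qed
  have less: "p i a < p i b" if ab: "a < n" "b < n" "a \<noteq> b"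
    and i: "i \<in> A (D a b) \<longleftrightarrow> D a b \<in> \<beta> a" for i a b
  proof -
    \<comment> \<open>The common xor cancels, so \<open>D a b\<close> remains the deciding
      coordinate in every order \<open>i\<close>.\<close>
    have sd: "sym_diff (sym_diff (\<beta> a) (M i)) (sym_diff (\<beta> b) (M i)) = sym_diff (\<beta> a) (\<beta> b)"
      by blast
    have "D a b \<in> sym_diff (\<beta> b) (M i)"
      using D[OF ab] i by (auto simp: M_def)
    moreover have "sym_diff (\<beta> a) (M i) \<noteq> sym_diff (\<beta> b) (M i)"
      using D(1)[OF ab] by blast
    moreover have "finite (M i)" by (simp add: M_def)
    ultimately show ?thesis
      unfolding p_def using fin[OF ab(1)] fin[OF ab(2)]
      by (subst sum_power2_less_iff_Max_sym_diff) (simp_all only: sd D_def finite_Un finite_Diff simp_thms)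
  qed
  have "\<exists>i<2 * s. p i a < p i b \<and> p i a < p i c"
    if abc: "a < n" "b < n" "c < n" "a \<noteq> b" "a \<noteq> c" for a b c
  proof -
    have "D a b < m" "D a c < m" using D(2) abc by blast+
    \<comment> \<open>If \<open>D a b = D a c\<close>, both demands ask about the same coordinate of
      \<open>\<beta> a\<close> and hence agree.\<close>
    then have "\<exists>i<2 * s. (i \<in> A (D a b) \<longleftrightarrow> D a b \<in> \<beta> a) \<and> (i \<in> A (D a c) \<longleftrightarrow> D a c \<in> \<beta> a)"
      by (intro A) simp_all
    then show ?thesis using less abc by blast
  qed
  with that show thesis by blast
qed

section \<open>Separating the edges of the subdivision\<close>

lemma chromatic_number_coloring:
  assumes "simple_graph G"
  obtains c where "proper_coloring G (chromatic_number G) c"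
proof -
  have fin: "finite (verts G)" using assms by (simp add: simple_graph_def)
  obtain f :: "'a \<Rightarrow> nat" and n where f: "f ` verts G = {i. i < n}" "inj_on f (verts G)"
    using finite_imp_inj_to_nat_seg[OF fin] by blast
  have "f x \<noteq> f y" if "{x, y} \<in> edges G" for x y
  proof -
    have "{x, y} \<subseteq> verts G" "card {x, y} = 2"
      using assms that by (auto simp: simple_graph_def)
    then have "x \<noteq> y" "x \<in> verts G" "y \<in> verts G" by auto
    with f(2) show ?thesis by (auto simp: inj_on_def)
  qed
  then have "proper_coloring G n f"
    using f(1) by (auto simp: proper_coloring_def)
  then have "\<exists>c. proper_coloring G (chromatic_number G) c"
    unfolding chromatic_number_def by (intro LeastI) blast
  with that show thesis by blast
qed

text \<open>The last component orders the subdivision vertices anchored at a common endpoint by their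
  other endpoints.\<close>

definition subdivision_key ::
    "('a \<Rightarrow> 'b::linorder) \<Rightarrow> 'a + 'a set \<Rightarrow> 'b \<times> nat \<times> 'b" where
  "subdivision_key g u =
     (case u of Inl v \<Rightarrow> (g v, 0, g v) | Inr e \<Rightarrow> (Min (g ` e), 1, Max (g ` e)))"

lemma subdivision_key_simps [simp]:
  "subdivision_key g (Inl v) = (g v, 0, g v)"
  "subdivision_key g (Inr {x, y}) = (min (g x) (g y), 1, max (g x) (g y))"
  by (simp_all add: subdivision_key_def)

definition separates_by :: "('a \<Rightarrow> 'b::linorder) \<Rightarrow> 'a set \<Rightarrow> 'a set \<Rightarrow> bool" where
  "separates_by k A B \<longleftrightarrow> (\<forall>a\<in>A. \<forall>b\<in>B. k a < k b) \<or> (\<forall>a\<in>A. \<forall>b\<in>B. k b < k a)"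

lemma separates_by_commute: "separates_by k A B \<longleftrightarrow> separates_by k B A"
  by (auto simp: separates_by_def)

lemma separation_dimension_le_keys:
  fixes k :: "nat \<Rightarrow> 'a \<Rightarrow> 'b::linorder"
  assumes fin: "finite (verts H)" and sub: "\<And>e. e \<in> edges H \<Longrightarrow> e \<subseteq> verts H"
    and sep: "\<And>e f. e \<in> edges H \<Longrightarrow> f \<in> edges H \<Longrightarrow> e \<inter> f = {} \<Longrightarrow>
      \<exists>i<t. separates_by (k i) e f"
  shows "separation_dimension H \<le> t"
proof -
  have "\<exists>\<sigma>. \<sigma> \<in> permutations_on (verts H) \<and>
      (\<forall>u\<in>verts H. \<forall>v\<in>verts H. k i u < k i v \<longrightarrow> \<sigma> u < \<sigma> v)" for i
    using permutation_from_key[OF fin, of "k i"] by metis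
  then obtain \<sigma> where \<sigma>: "\<And>i. \<sigma> i \<in> permutations_on (verts H)"
    "\<And>i u v. u \<in> verts H \<Longrightarrow> v \<in> verts H \<Longrightarrow> k i u < k i v \<Longrightarrow> \<sigma> i u < \<sigma> i v"
    by metis
  have "\<exists>\<rho>\<in>\<sigma> ` {..<t}. separates \<rho> e f"
    if ef: "e \<in> edges H" "f \<in> edges H" "e \<inter> f = {}" for e f
  proof -
    obtain i where "i < t" "separates_by (k i) e f" using sep[OF ef] by blast
    moreover from this have "separates (\<sigma> i) e f"
      using \<sigma>(2) sub[OF ef(1)] sub[OF ef(2)]
      unfolding separates_by_def separates_def precedes_def by (meson subsetD)
    ultimately show ?thesis by blast
  qed
  then have "pairwise_suitable H (\<sigma> ` {..<t})"
    using \<sigma>(1) by (auto simp: pairwise_suitable_def)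
  then have "separation_dimension H \<le> card (\<sigma> ` {..<t})"
    unfolding separation_dimension_def by (intro Least_le) blast
  also have "\<dots> \<le> t" using card_image_le[of "{..<t}" \<sigma>] by simp
  finally show ?thesis .
qed

lemma separation_dimension_subdivision_le:
  assumes G: "simple_graph G" and c: "proper_coloring G n c"
    and s: "s \<ge> 1" and n: "n \<le> 2 ^ ((2 * s - 1) choose (s - 1))"
  shows "separation_dimension (subdivision G) \<le> 2 * s + 2"
proof -
  have fin: "finite (verts G)" using G by (simp add: simple_graph_def)
  obtain \<tau> N where \<tau>: "\<tau> ` verts G = {i::nat. i < N}" "inj_on \<tau> (verts G)"
    using finite_imp_inj_to_nat_seg[OF fin] by blast
  have \<tau>_less: "\<tau> x < N" if "x \<in> verts G" for x using \<tau>(1) that by blast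
  have \<tau>_neq: "\<tau> x \<noteq> \<tau> y" if "x \<in> verts G" "y \<in> verts G" "x \<noteq> y" for x y
    using \<tau>(2) that by (auto simp: inj_on_def)
  obtain p :: "nat \<Rightarrow> nat \<Rightarrow> nat" where p: "\<And>a b c. a < n \<Longrightarrow> b < n \<Longrightarrow> c < n \<Longrightarrow> a \<noteq> b \<Longrightarrow> a \<noteq> c \<Longrightarrow>
       \<exists>i<2 * s. p i a < p i b \<and> p i a < p i c"
    using scrambling_orders[OF s n] by metis
  \<comment> \<open>Colour first, then \<open>\<tau>\<close> within a class. The orders
    \<open>2 * s\<close> and \<open>2 * s + 1\<close> are opposite within classes: as
    \<open>\<tau> v < N\<close>, the truncated \<open>N - \<tau> v\<close> is strictly decreasing in
    \<open>\<tau> v\<close>.\<close>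
  define g where "g i v = (if i < 2 * s then (p i (c v), \<tau> v)
      else if i = 2 * s then (c v, \<tau> v) else (c v, N - \<tau> v))" for i v
  have c_less: "c v < n" if "v \<in> verts G" for v
    using c that by (auto simp: proper_coloring_def)
  define sep where "sep x x' y y' \<longleftrightarrow> (\<exists>i<2 * s + 2. separates_by (subdivision_key (g i))
      {Inl x, Inr {x, x'}} {Inl y, Inr {y, y'}})" for x x' y y'
  have sepI: "sep x x' y y'" if "separates_by (subdivision_key (g i))
      {Inl x, Inr {x, x'}} {Inl y, Inr {y, y'}}" "i < 2 * s + 2" for i x x' y y'
    using that unfolding sep_def by blast
  have sep_sym: "sep x x' y y' \<longleftrightarrow> sep y y' x x'" for x x' y y'
    using separates_by_commute unfolding sep_def by blast
  \<comment> \<open>Put the colour of \<open>x\<close> below those of \<open>y\<close> and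
    \<open>y'\<close>. The vertex on \<open>{x, x'}\<close> is anchored at \<open>x\<close> or
    lower, whatever \<open>x'\<close> is.\<close>
  have colors_apart: "sep x x' y y'"
    if A: "c x \<noteq> c y" "c x \<noteq> c y'" "x \<in> verts G" "y \<in> verts G" "y' \<in> verts G" for x x' y y'
  proof -
    obtain i where i: "i < 2 * s" "p i (c x) < p i (c y)" "p i (c x) < p i (c y')"
      using p[of "c x" "c y" "c y'"] c_less A by metis
    then have "g i x < g i y" "g i x < g i y'" by (auto simp: g_def)
    then have "separates_by (subdivision_key (g i)) {Inl x, Inr {x, x'}} {Inl y, Inr {y, y'}}"
      unfolding separates_by_def by (intro disjI1) (auto simp: min_def)
    then show ?thesis using i(1) by (intro sepI) auto
  qed
  \<comment> \<open>Put the common colour below those of \<open>x'\<close> and \<open>y'\<close>.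
    Both new vertices are then anchored at \<open>x\<close> and \<open>y\<close>, whose order
    decides.\<close>
  have same_color: "sep x x' y y'"
    if A: "c x = c y" "c x \<noteq> c x'" "c y \<noteq> c y'" "x \<noteq> y"
      "x \<in> verts G" "y \<in> verts G" "x' \<in> verts G" "y' \<in> verts G" for x x' y y'
  proof -
    obtain i where i: "i < 2 * s" "p i (c x) < p i (c x')" "p i (c y) < p i (c y')"
      using p[of "c x" "c x'" "c y'"] c_less A by metis
    then have g: "g i x < g i x'" "g i y < g i y'" by (auto simp: g_def)
    have "g i x \<noteq> g i y" using \<tau>_neq that i by (auto simp: g_def)
    then have "separates_by (subdivision_key (g i)) {Inl x, Inr {x, x'}} {Inl y, Inr {y, y'}}"
      unfolding separates_by_def using g
      by (cases "g i x" "g i y" rule: linorder_cases) (auto simp: min_def)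
    then show ?thesis using i(1) by (intro sepI) auto
  qed
  \<comment> \<open>Now the anchors are \<open>x\<close> and \<open>y'\<close>, of equal colour, so
    it suffices that \<open>x\<close> precedes \<open>y'\<close>, which one of the two extra orders
    ensures. If \<open>x = y'\<close>, the anchors coincide and the last key component compares
    \<open>x'\<close> with \<open>y\<close> instead.\<close>
  have crossed: "sep x x' y y'"
    if A: "c x = c y'" "c x' = c y" "c x < c y" "x \<noteq> y' \<or> x' \<noteq> y"
      "x \<in> verts G" "y \<in> verts G" "x' \<in> verts G" "y' \<in> verts G" for x x' y y'
  proof -
    have reach: "\<exists>i<2 * s + 2. \<not> i < 2 * s \<and> g i u < g i v"
      if "c u = c v" "u \<noteq> v" "u \<in> verts G" "v \<in> verts G" for u v
    proof (cases "\<tau> u < \<tau> v")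
      case True
      then show ?thesis using that by (intro exI[of _ "2 * s"]) (simp add: g_def)
    next
      case False
      then have "\<tau> v < \<tau> u" using \<tau>_neq[of u v] that by linarith
      then have "N - \<tau> u < N - \<tau> v" using \<tau>_less[of u] that by linarith
      then show ?thesis using that by (intro exI[of _ "Suc (2 * s)"]) (simp add: g_def)
    qed
    have small: "g i x < g i y" "g i x < g i x'" "g i y' < g i y" if "\<not> i < 2 * s" for i
      using \<open>c x = c y'\<close> \<open>c x' = c y\<close> \<open>c x < c y\<close> that by (auto simp: g_def)
    obtain i where i: "i < 2 * s + 2" "\<not> i < 2 * s"
      "g i x < g i y' \<or> x = y' \<and> g i x' < g i y"
      using reach[of x y'] reach[of x' y] A by metis
    then have "separates_by (subdivision_key (g i)) {Inl x, Inr {x, x'}} {Inl y, Inr {y, y'}}"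
      unfolding separates_by_def using small[OF i(2)]
      by (intro disjI1) (auto simp: min_def max_def)
    then show ?thesis using i(1) by (intro sepI) auto
  qed
  have sep: "sep x x' y y'"
    if e: "{x, x'} \<in> edges G" and f: "{y, y'} \<in> edges G" and ne: "x \<noteq> y" "{x, x'} \<noteq> {y, y'}"
    for x x' y y'
  proof -
    have V: "x \<in> verts G" "y \<in> verts G" "x' \<in> verts G" "y' \<in> verts G"
      using G e f by (auto simp: simple_graph_def)
    have cc: "c x \<noteq> c x'" "c y \<noteq> c y'"
      using c e f by (auto simp: proper_coloring_def)
    \<comment> \<open>Failure of the first three cases forces both colour equalities of the crossed
      case; there \<open>{x, x'} \<noteq> {y, y'}\<close> excludes having both \<open>x = y'\<close>
      and \<open>x' = y\<close>.\<close>
    consider "c x \<noteq> c y" "c x \<noteq> c y'" | "c y \<noteq> c x" "c y \<noteq> c x'" | "c x = c y"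
      | "c x = c y'" "c y = c x'" "c x < c y" | "c x = c y'" "c y = c x'" "c y < c x"
      by linarith
    then show ?thesis
    proof cases
      case 1 then show ?thesis using colors_apart V by blast
    next
      case 2 then show ?thesis using colors_apart V sep_sym by blast
    next
      case 3 then show ?thesis using same_color cc ne V by blast
    next
      case 4 then show ?thesis using crossed[of x y' x' y] ne V by auto
    next
      case 5 then show ?thesis using crossed[of y x' y' x] ne V sep_sym by auto
    qed
  qed
  have pair: "\<exists>x'. e = {x, x'}" if "e \<in> edges G" "x \<in> e" for e x
  proof -
    have "card e = 2" using G that by (simp add: simple_graph_def)
    then show ?thesis using that(2) by (auto simp: card_2_iff)
  qed
  show ?thesis
  proof (rule separation_dimension_le_keys[where k = "\<lambda>i. subdivision_key (g i)"])
    have "edges G \<subseteq> Pow (verts G)" using G by (auto simp: simple_graph_def)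
    then have "finite (edges G)" using fin by (meson finite_Pow_iff finite_subset)
    then show "finite (verts (subdivision G))"
      using fin by (simp add: subdivision_def)
  next
    fix e assume "e \<in> edges (subdivision G)"
    then show "e \<subseteq> verts (subdivision G)"
      using G by (auto simp: subdivision_def simple_graph_def)
  next
    fix d d' assume d: "d \<in> edges (subdivision G)" "d' \<in> edges (subdivision G)" "d \<inter> d' = {}"
    then obtain x e y f where e: "e \<in> edges G" "x \<in> e" "d = {Inl x, Inr e}"
      and f: "f \<in> edges G" "y \<in> f" "d' = {Inl y, Inr f}"
      by (auto simp: subdivision_def)
    moreover obtain x' y' where "e = {x, x'}" "f = {y, y'}" using pair e f by metis
    ultimately show "\<exists>i<2 * s + 2. separates_by (subdivision_key (g i)) d d'"
      using sep[of x x' y y'] d(3) unfolding sep_def by auto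
  qed
qed

section \<open>Central binomial bound and asymptotics\<close>

lemma half_central_binomial:
  assumes "s \<ge> 1"
  shows "(2 * s) choose s = 2 * ((2 * s - 1) choose (s - 1))"
proof -
  obtain r where r: "s = Suc r" using assms by (cases s) auto
  have "Suc (2 * r) choose Suc r = Suc (2 * r) choose r"
    using binomial_symmetric[of r "Suc (2 * r)"] by simp
  then show ?thesis by (simp add: r)
qed

text \<open>Squaring removes the root and permits induction over the naturals; the induction step
  comes down to \<open>4 * n * (n + 1) \<le> (2 * n + 1) ^ 2\<close>.\<close>

lemma central_binomial_sqrt_lower_bound:
  assumes "n \<ge> 1"
  shows "4 ^ n \<le> 2 * sqrt (real n) * real ((2 * n) choose n)"
proof -
  have "16 ^ n \<le> 4 * n * ((2 * n) choose n) ^ 2"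
    using assms
  proof (induction n rule: nat_induct_at_least)
    case base
    show ?case by simp
  next
    case (Suc n)
    define B where "B = (2 * n) choose n"
    define C where "C = (2 * Suc n) choose Suc n"
    have "(Suc (2 * n) choose Suc n) * Suc n = Suc (2 * n) * B"
      unfolding B_def by (rule Suc_times_binomial_eq[symmetric])
    moreover have "C = 2 * (Suc (2 * n) choose Suc n)"
      using half_central_binomial[of "Suc n"] binomial_symmetric[of n "Suc (2 * n)"]
      by (simp add: C_def)
    ultimately have BC: "Suc n * C = 2 * (2 * n + 1) * B"
      by (simp add: algebra_simps)
    \<comment> \<open>The positive factor \<open>n * Suc n\<close> lets the recurrence
      \<open>BC\<close> apply without division and cancels at the end.\<close>
    have "n * Suc n * 16 ^ Suc n \<le> n * Suc n * 16 * (4 * n * B ^ 2)"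
      using mult_le_mono2[OF Suc.IH, of "n * Suc n * 16"]
      by (simp only: B_def power_Suc mult.assoc)
    also have "\<dots> = 16 * B ^ 2 * n * (4 * n * Suc n)" by (simp add: power2_eq_square)
    also have "\<dots> \<le> 16 * B ^ 2 * n * (2 * n + 1) ^ 2"
      by (intro mult_left_mono) (auto simp: power2_eq_square algebra_simps)
    also have "\<dots> = 4 * n * (2 * (2 * n + 1) * B) ^ 2"
      by (simp add: power2_eq_square algebra_simps)
    also have "\<dots> = n * Suc n * (4 * Suc n * C ^ 2)"
      unfolding BC[symmetric] by (simp add: power2_eq_square algebra_simps)
    finally show ?case using Suc.hyps by (simp add: C_def)
  qed
  then have "real (16 ^ n) \<le> real (4 * n * ((2 * n) choose n) ^ 2)"
    by (simp only: of_nat_le_iff)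
  moreover have "(4 ^ n)\<^sup>2 = (16 :: real) ^ n"
    by (simp add: power2_eq_square flip: power_mult_distrib)
  ultimately have "(4 ^ n)\<^sup>2 \<le> (2 * sqrt (real n) * real ((2 * n) choose n))\<^sup>2"
    by (simp add: power_mult_distrib)
  then show ?thesis by (rule power2_le_imp_le) simp
qed

theorem theorem3:
  "\<exists>\<epsilon> :: nat \<Rightarrow> real. \<epsilon> \<longlonglongrightarrow> 0 \<and>
     (\<exists>N. \<forall>G :: 'a graph. simple_graph G \<longrightarrow> chromatic_number G \<ge> N \<longrightarrow>
        real (separation_dimension (subdivision G)) \<le>
          log 2 (log 2 (real (chromatic_number G) - 1))
          + (1 / 2 + \<epsilon> (chromatic_number G))
              * log 2 (log 2 (log 2 (real (chromatic_number G) - 1)))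
          + 2)"
proof -
  define x where "x n = log 2 (real n - 1)" for n :: nat
  define y where "y n = log 2 (x n)" for n
  define z where "z n = log 2 (y n)" for n
  \<comment> \<open>Rounding gives \<open>2 * s \<le> y n + z n / 2 + 6\<close>; the excess 6 is
    written as \<open>(6 / z n) * z n\<close>.\<close>
  have lim: "(\<lambda>n. 6 / z n) \<longlonglongrightarrow> 0"
    unfolding z_def y_def x_def by real_asymp
  \<comment> \<open>The factor 4 absorbs the passage from \<open>n\<close> to
    \<open>n - 1\<close>.\<close>
  have "eventually (\<lambda>n. log 2 (real n) \<le> 4 * x n) at_top"
    unfolding x_def by real_asymp
  \<comment> \<open>This will give \<open>s \<le> y n\<close>, hence
    \<open>sqrt s \<le> 2 powr (z n / 2)\<close>.\<close>
  moreover have "eventually (\<lambda>n. y n / 2 + z n / 4 + 3 \<le> y n) at_top"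
    unfolding z_def y_def x_def by real_asymp
  moreover have "eventually (\<lambda>n. z n > 0) at_top" "eventually (\<lambda>n. y n > 0) at_top"
      "eventually (\<lambda>n. x n > 0) at_top"
    unfolding z_def y_def x_def by real_asymp+
  ultimately have "eventually (\<lambda>n. n \<ge> 1 \<and> log 2 (real n) \<le> 4 * x n \<and> y n / 2 + z n / 4 + 3 \<le> y n \<and>
      z n > 0 \<and> y n > 0 \<and> x n > 0) at_top"
    using eventually_ge_at_top[of 1] by eventually_elim auto
  then obtain N where N: "\<And>n. n \<ge> N \<Longrightarrow> n \<ge> 1 \<and> log 2 (real n) \<le> 4 * x n \<and>
      y n / 2 + z n / 4 + 3 \<le> y n \<and> z n > 0 \<and> y n > 0 \<and> x n > 0"
    by (auto simp: eventually_at_top_linorder)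
  have "real (separation_dimension (subdivision G)) \<le> y n + (1 / 2 + 6 / z n) * z n + 2"
    if G: "simple_graph G" and n: "n = chromatic_number G" "n \<ge> N" for G :: "'a graph" and n
  proof -
    note N = N[OF n(2)]
    \<comment> \<open>the \<open>z n / 4\<close> pays for the factor \<open>sqrt s\<close> in the bound on the central binomial coefficient\<close>
    define s where "s = nat \<lceil>y n / 2 + z n / 4 + 2\<rceil>"
    have s: "y n / 2 + z n / 4 + 2 \<le> real s" "real s \<le> y n / 2 + z n / 4 + 3"
      using N by (simp_all add: s_def) linarith+
    have s1: "s \<ge> 1" using s N by linarith
    define C where "C = real ((2 * s - 1) choose (s - 1))"
    have x: "x n = 2 powr y n" and y: "y n = 2 powr z n"
      using N by (simp_all add: y_def z_def)
    have "sqrt (real s) \<le> sqrt (2 powr z n)"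
      using s N y by (intro real_sqrt_le_mono) linarith
    then have "sqrt (real s) \<le> 2 powr (z n / 2)"
      by (simp add: powr_powr flip: powr_half_sqrt)
    \<comment> \<open>Of \<open>2 powr 4 = 4 * 4\<close>, one 4 cancels against \<open>4 * C\<close>
      and the other yields \<open>4 * x n \<le> C\<close>. The exponent 4 is twice the summand 2 in
      \<open>s\<close>.\<close>
    then have "2 powr 4 * x n * sqrt (real s) \<le> 2 powr 4 * x n * 2 powr (z n / 2)"
      using N by (intro mult_left_mono) auto
    also have "\<dots> = 2 powr (4 + y n + z n / 2)"
      by (simp only: x powr_add)
    also have "\<dots> \<le> 2 powr (2 * real s)"
      using s by (intro powr_mono) auto
    also have "\<dots> = 4 ^ s"
      by (simp add: powr_realpow flip: powr_powr)
    also have "\<dots> \<le> 4 * C * sqrt (real s)"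
      using central_binomial_sqrt_lower_bound[OF s1] half_central_binomial[OF s1]
      by (simp add: C_def mult_ac)
    finally have "2 powr 4 * x n \<le> 4 * C"
      using s1 by simp
    then have "log 2 (real n) \<le> C" using N by simp
    then have "real n \<le> 2 powr C"
      using N by (simp add: log_le_iff)
    then have "real n \<le> real (2 ^ ((2 * s - 1) choose (s - 1)))"
      by (simp add: C_def powr_realpow)
    then have "n \<le> 2 ^ ((2 * s - 1) choose (s - 1))"
      by (simp only: of_nat_le_iff)
    moreover obtain c where "proper_coloring G n c"
      using chromatic_number_coloring[OF G] n by metis
    ultimately have "separation_dimension (subdivision G) \<le> 2 * s + 2"
      using separation_dimension_subdivision_le[OF G _ s1] by blast
    then have "real (separation_dimension (subdivision G)) \<le> 2 * real s + 2"
      by linarith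
    also have "\<dots> \<le> y n + (1 / 2 + 6 / z n) * z n + 2"
      using s N by (simp add: algebra_simps)
    finally show ?thesis .
  qed
  then show ?thesis
    using lim unfolding x_def y_def z_def by blast
qed

end
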